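(* Let $0<\pi\le1$ and let $\chi$ be the Geometric$(\pi)$ distribution, i.e. $\chi(m)=(1-\pi)^m\pi$ for $m\in\mathbb{N}_0$. Then for every $(p,q)\in[0,1]^2$ with $0<p+q<1$, the probability that the bond percolation game with parameter-pair $(p,q)$, played on the rooted Galton-Watson tree $T_\chi$ starting from its root, results in a draw is $0$.
   Context: Here $\pi$ is a parameter (not the circle constant). $\mathbb{N}_0=\{0,1,2,\dots\}$, and $0^0=1$. $T_\chi$ is the rooted Galton-Watson tree with root $\phi$ in which the numbers of children of the vertices are i.i.d. with law $\chi$. Each edge $\{u,v\}$ ($u$ the parent of $v$) is directed from $u$ to $v$. Bond percolation game with parameter-pair $(p,q)$: given $T_\chi$, each edge is independently labeled trap with probability $p$, target with probability $q$, safe with probability $1-p-q$. The tree and all labels are revealed to both players (perfect information). Two players alternately move a token, initially at $\phi$; a move takes the token from its current vertex $u$ along a directed edge to a child of $u$. A player who moves the token along a target edge wins immediately; a player who moves it along a trap edge loses immediately; a player whose turn it is to move when the token is at a leaf (childless vertex) loses. If the game continues forever it is a draw. Both players play optimally: for a given realization, the game is won (respectively lost) by the first player if the first (respectively second) player has a strategy guaranteeing a win for herself in finitely many rounds against any play of the opponent; otherwise the game results in a draw. *)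

theory Defs
  imports "HOL-Probability.Probability"
begin

text \<open>
  Rooted ordered trees are given in Ulam-Harris encoding: the root is the empty word, and the
  children of \<open>v\<close> are the words \<open>v @ [k]\<close> with \<open>k\<close> less than the number of
  children of \<open>v\<close>.  The directed edge from a vertex to its child \<open>v\<close> is identified with
  \<open>v\<close>.
\<close>

type_synonym vertex = "nat list"

datatype label = Trap | Target | Safe

text \<open>
  An environment attaches a number of children and a label to every word; the values at words
  outside the tree, and the label at the root, play no role.
\<close>

type_synonym env = "vertex \<Rightarrow> nat \<times> label"

definition num_children :: "env \<Rightarrow> vertex \<Rightarrow> nat" where
  "num_children \<omega> v = fst (\<omega> v)"

definition edge_label :: "env \<Rightarrow> vertex \<Rightarrow> label" where
  "edge_label \<omega> v = snd (\<omega> v)"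

inductive_set vertices :: "env \<Rightarrow> vertex set" for \<omega> :: env where
  root: "[] \<in> vertices \<omega>"
| child: "v \<in> vertices \<omega> \<Longrightarrow> k < num_children \<omega> v \<Longrightarrow> v @ [k] \<in> vertices \<omega>"

text \<open>
  In a tree the position of the token determines the history of the play, so a strategy is
  a choice of a child at every vertex that has one.
\<close>

type_synonym strategy = "vertex \<Rightarrow> nat"

definition legal_strategy :: "env \<Rightarrow> strategy \<Rightarrow> bool" where
  "legal_strategy \<omega> \<sigma> \<longleftrightarrow>
     (\<forall>v\<in>vertices \<omega>. num_children \<omega> v > 0 \<longrightarrow> \<sigma> v < num_children \<omega> v)"

datatype player = First | Second

text \<open>Rounds are numbered from 0.\<close>

definition mover :: "nat \<Rightarrow> player" where
  "mover n = (if even n then First else Second)"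

text \<open>
  The position of the token after \<open>n\<close> moves, when the first player uses \<open>\<sigma>\<close> and the
  second player uses \<open>\<tau>\<close>; it is only meaningful as long as the game has not ended before.
\<close>

primrec token :: "strategy \<Rightarrow> strategy \<Rightarrow> nat \<Rightarrow> vertex" where
  "token \<sigma> \<tau> 0 = []"
| "token \<sigma> \<tau> (Suc n) =
     token \<sigma> \<tau> n @ [(case mover n of First \<Rightarrow> \<sigma> | Second \<Rightarrow> \<tau>) (token \<sigma> \<tau> n)]"

definition mover_wins_at :: "env \<Rightarrow> strategy \<Rightarrow> strategy \<Rightarrow> nat \<Rightarrow> bool" where
  "mover_wins_at \<omega> \<sigma> \<tau> n \<longleftrightarrow>
     num_children \<omega> (token \<sigma> \<tau> n) > 0 \<and> edge_label \<omega> (token \<sigma> \<tau> (Suc n)) = Target"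

definition mover_loses_at :: "env \<Rightarrow> strategy \<Rightarrow> strategy \<Rightarrow> nat \<Rightarrow> bool" where
  "mover_loses_at \<omega> \<sigma> \<tau> n \<longleftrightarrow>
     num_children \<omega> (token \<sigma> \<tau> n) = 0 \<or> edge_label \<omega> (token \<sigma> \<tau> (Suc n)) = Trap"

definition play_won_by :: "env \<Rightarrow> strategy \<Rightarrow> strategy \<Rightarrow> player \<Rightarrow> bool" where
  "play_won_by \<omega> \<sigma> \<tau> P \<longleftrightarrow>
     (\<exists>n. (\<forall>m<n. \<not> mover_wins_at \<omega> \<sigma> \<tau> m \<and> \<not> mover_loses_at \<omega> \<sigma> \<tau> m) \<and>
          (if mover n = P then mover_wins_at \<omega> \<sigma> \<tau> n else mover_loses_at \<omega> \<sigma> \<tau> n))"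

definition won :: "env \<Rightarrow> bool" where
  "won \<omega> \<longleftrightarrow> (\<exists>\<sigma>. legal_strategy \<omega> \<sigma> \<and>
     (\<forall>\<tau>. legal_strategy \<omega> \<tau> \<longrightarrow> play_won_by \<omega> \<sigma> \<tau> First))"

definition lost :: "env \<Rightarrow> bool" where
  "lost \<omega> \<longleftrightarrow> (\<exists>\<tau>. legal_strategy \<omega> \<tau> \<and>
     (\<forall>\<sigma>. legal_strategy \<omega> \<sigma> \<longrightarrow> play_won_by \<omega> \<sigma> \<tau> Second))"

definition draw :: "env \<Rightarrow> bool" where
  "draw \<omega> \<longleftrightarrow> \<not> won \<omega> \<and> \<not> lost \<omega>"

definition label_pmf :: "real \<Rightarrow> real \<Rightarrow> label pmf" where
  "label_pmf p q =
     embed_pmf (\<lambda>l. case l of Trap \<Rightarrow> p | Target \<Rightarrow> q | Safe \<Rightarrow> 1 - p - q)"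

lemma UNIV_label: "UNIV = {Trap, Target, Safe}"
  using label.exhaust by auto

text \<open>\<^const>\<open>embed_pmf\<close> is only meaningful for nonnegative weights of total mass 1.\<close>

lemma pmf_label_pmf:
  assumes "0 \<le> p" "0 \<le> q" "p + q \<le> 1"
  shows "pmf (label_pmf p q) l = (case l of Trap \<Rightarrow> p | Target \<Rightarrow> q | Safe \<Rightarrow> 1 - p - q)"
  unfolding label_pmf_def
proof (rule pmf_embed_pmf)
  show "0 \<le> (case l of Trap \<Rightarrow> p | Target \<Rightarrow> q | Safe \<Rightarrow> 1 - p - q)" for l
    using assms by (cases l) auto
  have "(\<integral>\<^sup>+ l. ennreal (case l of Trap \<Rightarrow> p | Target \<Rightarrow> q | Safe \<Rightarrow> 1 - p - q)
           \<partial>count_space UNIV) = ennreal p + ennreal q + ennreal (1 - p - q)"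
    by (subst nn_integral_count_space_finite) (simp_all add: UNIV_label add.assoc)
  also have "\<dots> = 1"
    using assms by (simp flip: ennreal_plus)
  finally show "(\<integral>\<^sup>+ l. ennreal (case l of Trap \<Rightarrow> p | Target \<Rightarrow> q | Safe \<Rightarrow> 1 - p - q)
           \<partial>count_space UNIV) = 1" .
qed

text \<open>
  The law of the Galton-Watson tree with offspring distribution \<open>D\<close> and labelled edges:
  the numbers of children and the labels of all words are independent.
\<close>

definition game_space :: "nat pmf \<Rightarrow> real \<Rightarrow> real \<Rightarrow> env measure" where
  "game_space D p q =
     (\<Pi>\<^sub>M v\<in>UNIV. measure_pmf (pair_pmf D (label_pmf p q)))"

end

theory Submission
  imports Defs
begin

text \<open>
  Backward induction on a finitely branching tree turns winning and losing into recursive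
  conditions on the subtrees of the root. If \<open>a\<close> is the probability of not winning, \<open>b\<close> that of
  losing, and \<open>G\<close> is the generating function of the offspring law, then with \<open>s = 1 - p - q\<close>
  the recursion reads \<open>a = G (p + s - s b)\<close> and \<open>b = G (p + s - s a)\<close>. For the geometric law
  \<open>G\<close> is a Moebius transformation: clearing denominators and subtracting the two equations makes
  the terms in \<open>a b\<close> cancel and leaves \<open>(b - a) (1 - (1 - \<pi>) (1 - q)) = 0\<close>, so \<open>a = b\<close>, and
  \<open>a - b\<close> is the probability of a draw.
\<close>

section \<open>Backward induction\<close>

lemma not_Target_iff: "l \<noteq> Target \<longleftrightarrow> l = Trap \<or> l = Safe"
  by (cases l) auto

text \<open>An edge is named by its lower end, so the root of the subtree at a child carries the
  label of the edge into that child. A condition on a move thus becomes an event of the subtree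
  alone.\<close>

definition subtree :: "env \<Rightarrow> vertex \<Rightarrow> env" where
  "subtree \<omega> v = (\<lambda>u. \<omega> (v @ u))"

text \<open>The bound counts rounds, including the one in which a player is stuck: a leaf is lost
  within 1, and nothing is decided within 0.\<close>

fun wins_within :: "nat \<Rightarrow> env \<Rightarrow> bool" and loses_within :: "nat \<Rightarrow> env \<Rightarrow> bool" where
  "wins_within 0 \<omega> \<longleftrightarrow> False"
| "wins_within (Suc n) \<omega> \<longleftrightarrow> (\<exists>k<num_children \<omega> []. edge_label \<omega> [k] = Target \<or>
     edge_label \<omega> [k] = Safe \<and> loses_within n (subtree \<omega> [k]))"
| "loses_within 0 \<omega> \<longleftrightarrow> False"
| "loses_within (Suc n) \<omega> \<longleftrightarrow> (\<forall>k<num_children \<omega> []. edge_label \<omega> [k] = Trap \<or>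
     edge_label \<omega> [k] = Safe \<and> wins_within n (subtree \<omega> [k]))"

definition wins :: "env \<Rightarrow> bool" where
  "wins \<omega> \<longleftrightarrow> (\<exists>n. wins_within n \<omega>)"

definition loses :: "env \<Rightarrow> bool" where
  "loses \<omega> \<longleftrightarrow> (\<exists>n. loses_within n \<omega>)"

lemma subtree_Nil [simp]: "subtree \<omega> [] = \<omega>"
  by (simp add: subtree_def)

lemma subtree_subtree [simp]: "subtree (subtree \<omega> v) u = subtree \<omega> (v @ u)"
  by (simp add: subtree_def)

lemma num_children_subtree [simp]: "num_children (subtree \<omega> v) u = num_children \<omega> (v @ u)"
  by (simp add: subtree_def num_children_def)

lemma edge_label_subtree [simp]: "edge_label (subtree \<omega> v) u = edge_label \<omega> (v @ u)"
  by (simp add: subtree_def edge_label_def)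

lemma within_mono:
  assumes "m \<le> n"
  shows wins_within_mono: "wins_within m \<omega> \<Longrightarrow> wins_within n \<omega>"
    and loses_within_mono: "loses_within m \<omega> \<Longrightarrow> loses_within n \<omega>"
proof -
  have "(wins_within m \<omega> \<longrightarrow> wins_within n \<omega>) \<and> (loses_within m \<omega> \<longrightarrow> loses_within n \<omega>)"
    using assms
  proof (induction m arbitrary: n \<omega>)
    case (Suc m)
    then obtain n' where "n = Suc n'" "m \<le> n'" by (cases n) auto
    with Suc.IH[of n'] show ?case by auto
  qed simp
  then show "wins_within m \<omega> \<Longrightarrow> wins_within n \<omega>" "loses_within m \<omega> \<Longrightarrow> loses_within n \<omega>"
    by auto
qed

lemma not_wins_and_loses_within: "\<not> (wins_within n \<omega> \<and> loses_within n \<omega>)"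
  by (induction n arbitrary: \<omega>) auto

lemma loses_imp_not_wins: "loses \<omega> \<Longrightarrow> \<not> wins \<omega>"
proof
  assume "loses \<omega>" "wins \<omega>"
  then obtain m n where "wins_within m \<omega>" "loses_within n \<omega>"
    by (auto simp: wins_def loses_def)
  then have "wins_within (max m n) \<omega>" "loses_within (max m n) \<omega>"
    by (auto elim: within_mono[rotated])
  then show False using not_wins_and_loses_within by blast
qed

lemma wins_iff:
  "wins \<omega> \<longleftrightarrow> (\<exists>k<num_children \<omega> []. edge_label \<omega> [k] = Target \<or>
     edge_label \<omega> [k] = Safe \<and> loses (subtree \<omega> [k]))" (is "_ \<longleftrightarrow> ?R")
proof
  assume "wins \<omega>"
  then obtain n where "wins_within n \<omega>" by (auto simp: wins_def)
  then show ?R by (cases n) (auto simp: loses_def)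
next
  assume ?R
  then obtain k n where "k < num_children \<omega> []" "edge_label \<omega> [k] = Target \<or>
    edge_label \<omega> [k] = Safe \<and> loses_within n (subtree \<omega> [k])"
    by (auto simp: loses_def)
  then have "wins_within (Suc n) \<omega>" by auto
  then show "wins \<omega>" unfolding wins_def by blast
qed

text \<open>Finite branching enters here: finitely many children, each with its own bound for the
  opponent's win, admit a common bound.\<close>

lemma loses_iff:
  "loses \<omega> \<longleftrightarrow> (\<forall>k<num_children \<omega> []. edge_label \<omega> [k] = Trap \<or>
     edge_label \<omega> [k] = Safe \<and> wins (subtree \<omega> [k]))" (is "_ \<longleftrightarrow> ?R")
proof
  assume "loses \<omega>"
  then obtain n where "loses_within n \<omega>" by (auto simp: loses_def)
  then show ?R by (cases n) (auto simp: wins_def)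
next
  assume R: ?R
  then have "\<forall>k<num_children \<omega> []. \<exists>n. edge_label \<omega> [k] = Trap \<or>
      edge_label \<omega> [k] = Safe \<and> wins_within n (subtree \<omega> [k])"
    by (auto simp: wins_def)
  then obtain f where f: "\<And>k. k < num_children \<omega> [] \<Longrightarrow> edge_label \<omega> [k] = Trap \<or>
      edge_label \<omega> [k] = Safe \<and> wins_within (f k) (subtree \<omega> [k])"
    by metis
  \<comment> \<open>The sum dominates every \<open>f k\<close> and, unlike a maximum, also makes
    sense at a leaf.\<close>
  have "loses_within (Suc (\<Sum>k<num_children \<omega> []. f k)) \<omega>"
  proof (subst loses_within.simps, intro allI impI)
    fix k assume k: "k < num_children \<omega> []"
    then have "f k \<le> (\<Sum>k<num_children \<omega> []. f k)"
      by (intro member_le_sum) auto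
    with f[OF k] show "edge_label \<omega> [k] = Trap \<or>
        edge_label \<omega> [k] = Safe \<and> wins_within (\<Sum>k<num_children \<omega> []. f k) (subtree \<omega> [k])"
      by (blast intro: wins_within_mono)
  qed
  then show "loses \<omega>" unfolding loses_def by blast
qed

section \<open>Strategies\<close>

definition ended_at :: "env \<Rightarrow> strategy \<Rightarrow> strategy \<Rightarrow> nat \<Rightarrow> bool" where
  "ended_at \<omega> \<sigma> \<tau> n \<longleftrightarrow> mover_wins_at \<omega> \<sigma> \<tau> n \<or> mover_loses_at \<omega> \<sigma> \<tau> n"

text \<open>Indexing the two strategies by the player lets the lemmas about plays treat both players
  at once.\<close>

definition owner :: "strategy \<Rightarrow> strategy \<Rightarrow> player \<Rightarrow> strategy" where
  "owner \<sigma> \<tau> P = (case P of First \<Rightarrow> \<sigma> | Second \<Rightarrow> \<tau>)"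

lemma owner_simps [simp]: "owner \<sigma> \<tau> First = \<sigma>" "owner \<sigma> \<tau> Second = \<tau>"
  by (simp_all add: owner_def)

lemma token_Suc:
  "token \<sigma> \<tau> (Suc n) = token \<sigma> \<tau> n @ [owner \<sigma> \<tau> (mover n) (token \<sigma> \<tau> n)]"
  by (simp add: owner_def)

lemma mover_Suc: "mover (Suc n) = P \<longleftrightarrow> mover n \<noteq> P"
  by (cases P) (auto simp: mover_def)

lemma not_ended_at_iff:
  "\<not> ended_at \<omega> \<sigma> \<tau> n \<longleftrightarrow>
     0 < num_children \<omega> (token \<sigma> \<tau> n) \<and> edge_label \<omega> (token \<sigma> \<tau> (Suc n)) = Safe"
  by (auto simp: ended_at_def mover_wins_at_def mover_loses_at_def not_Target_iff)

text \<open>Legality constrains a strategy only at vertices of the tree, so the token must be known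
  to stay there before a move can be called legal.\<close>

lemma token_vertices:
  assumes legal: "\<And>P. legal_strategy \<omega> (owner \<sigma> \<tau> P)"
    and "\<And>m. m < n \<Longrightarrow> \<not> ended_at \<omega> \<sigma> \<tau> m"
  shows "token \<sigma> \<tau> n \<in> vertices \<omega>"
  using assms(2)
proof (induction n)
  case (Suc n)
  then have "token \<sigma> \<tau> n \<in> vertices \<omega>" "0 < num_children \<omega> (token \<sigma> \<tau> n)"
    by (auto simp: not_ended_at_iff)
  then show ?case
    using legal unfolding token_Suc legal_strategy_def by (blast intro: vertices.child)
qed (simp add: vertices.root)

lemma move_legal:
  assumes legal: "\<And>P. legal_strategy \<omega> (owner \<sigma> \<tau> P)"
    and "\<And>m. m < n \<Longrightarrow> \<not> ended_at \<omega> \<sigma> \<tau> m"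
    and "0 < num_children \<omega> (token \<sigma> \<tau> n)"
  shows "owner \<sigma> \<tau> P (token \<sigma> \<tau> n) < num_children \<omega> (token \<sigma> \<tau> n)"
  using legal[of P] token_vertices[OF assms(1,2)] assms(3) by (auto simp: legal_strategy_def)

section \<open>Optimal positional strategies\<close>

text \<open>The choice at \<open>v\<close> may not depend on \<open>n\<close>. A child that works
  for the least bound within which \<open>v\<close> is won works for every larger bound by
  monotonicity.\<close>

lemma exists_winning_strategy:
  obtains \<rho> where "legal_strategy \<omega> \<rho>"
    and "\<And>v n. wins_within (Suc n) (subtree \<omega> v) \<Longrightarrow> edge_label \<omega> (v @ [\<rho> v]) = Target \<or>
      edge_label \<omega> (v @ [\<rho> v]) = Safe \<and> loses_within n (subtree \<omega> (v @ [\<rho> v]))"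
proof -
  define good where "good v n k \<longleftrightarrow> k < num_children \<omega> v \<and> (edge_label \<omega> (v @ [k]) = Target \<or>
      edge_label \<omega> (v @ [k]) = Safe \<and> loses_within n (subtree \<omega> (v @ [k])))" for v n k
  have good_mono: "good v n k" if "good v m k" "m \<le> n" for v m n k
    using that loses_within_mono by (auto simp: good_def)
  have "\<exists>k. (0 < num_children \<omega> v \<longrightarrow> k < num_children \<omega> v) \<and>
      (\<forall>n. wins_within (Suc n) (subtree \<omega> v) \<longrightarrow> good v n k)" for v
  proof (cases "\<exists>n. wins_within (Suc n) (subtree \<omega> v)")
    case True
    define n where "n = (LEAST n. wins_within (Suc n) (subtree \<omega> v))"
    have "wins_within (Suc n) (subtree \<omega> v)"
      unfolding n_def using True by (rule LeastI_ex)
    then obtain k where k: "good v n k" by (auto simp: good_def)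
    have "good v m k" if "wins_within (Suc m) (subtree \<omega> v)" for m
      using k by (rule good_mono) (use that in \<open>simp only: n_def Least_le\<close>)
    with k show ?thesis by (auto simp: good_def)
  qed auto
  then obtain \<rho> where "\<And>v. 0 < num_children \<omega> v \<Longrightarrow> \<rho> v < num_children \<omega> v"
    "\<And>v n. wins_within (Suc n) (subtree \<omega> v) \<Longrightarrow> good v n (\<rho> v)"
    by metis
  with that[of \<rho>] show thesis by (auto simp: good_def legal_strategy_def)
qed

text \<open>The negation of \<open>loses_iff\<close> supplies a child whose edge is no trap and
  which, if the edge is safe, is not won by the opponent. Such moves hold the draw and need no bound
  on the number of rounds.\<close>

lemma exists_non_losing_strategy:
  obtains \<rho> where "legal_strategy \<omega> \<rho>"
    and "\<And>v. \<not> loses (subtree \<omega> v) \<Longrightarrow> edge_label \<omega> (v @ [\<rho> v]) = Target \<or>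
      edge_label \<omega> (v @ [\<rho> v]) = Safe \<and> \<not> wins (subtree \<omega> (v @ [\<rho> v]))"
proof -
  have "\<exists>k. (0 < num_children \<omega> v \<longrightarrow> k < num_children \<omega> v) \<and> (\<not> loses (subtree \<omega> v) \<longrightarrow>
      edge_label \<omega> (v @ [k]) = Target \<or>
      edge_label \<omega> (v @ [k]) = Safe \<and> \<not> wins (subtree \<omega> (v @ [k])))" for v
    by (cases "loses (subtree \<omega> v)") (auto simp: loses_iff[of "subtree \<omega> v"] intro: label.exhaust)
  then obtain \<rho> where "\<And>v. 0 < num_children \<omega> v \<Longrightarrow> \<rho> v < num_children \<omega> v"
    "\<And>v. \<not> loses (subtree \<omega> v) \<Longrightarrow> edge_label \<omega> (v @ [\<rho> v]) = Target \<or>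
      edge_label \<omega> (v @ [\<rho> v]) = Safe \<and> \<not> wins (subtree \<omega> (v @ [\<rho> v]))"
    by metis
  with that[of \<rho>] show thesis by (auto simp: legal_strategy_def)
qed

section \<open>Invariants along a play\<close>

text \<open>Along the play the position is won within \<open>j\<close> when \<open>P\<close> moves
  and lost within \<open>j\<close> when the opponent moves, and \<open>j\<close> drops by one per
  round. The play therefore ends, and it can only end in favour of \<open>P\<close>.\<close>

lemma play_won_byI:
  assumes legal: "\<And>Q. legal_strategy \<omega> (owner \<sigma> \<tau> Q)"
    and best: "\<And>v n. wins_within (Suc n) (subtree \<omega> v) \<Longrightarrow>
      edge_label \<omega> (v @ [owner \<sigma> \<tau> P v]) = Target \<or>
      edge_label \<omega> (v @ [owner \<sigma> \<tau> P v]) = Safe \<and>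
      loses_within n (subtree \<omega> (v @ [owner \<sigma> \<tau> P v]))"
    and start: "if P = First then wins_within n \<omega> else loses_within n \<omega>"
  shows "play_won_by \<omega> \<sigma> \<tau> P"
proof -
  define good where "good j m \<longleftrightarrow> (if mover m = P then wins_within j (subtree \<omega> (token \<sigma> \<tau> m))
    else loses_within j (subtree \<omega> (token \<sigma> \<tau> m)))" for j m
  have step: "if ended_at \<omega> \<sigma> \<tau> m
      then if mover m = P then mover_wins_at \<omega> \<sigma> \<tau> m else mover_loses_at \<omega> \<sigma> \<tau> m
      else good j (Suc m)"
    if running: "\<And>i. i < m \<Longrightarrow> \<not> ended_at \<omega> \<sigma> \<tau> i" and good: "good (Suc j) m" for j m
  proof (cases "mover m = P")
    case True
    with good have w: "wins_within (Suc j) (subtree \<omega> (token \<sigma> \<tau> m))" by (simp add: good_def)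
    then have "0 < num_children \<omega> (token \<sigma> \<tau> m)" by auto
    with best[OF w] True show ?thesis
      by (auto simp: token_Suc good_def mover_Suc ended_at_def mover_wins_at_def mover_loses_at_def
          simp del: token.simps)
  next
    case False
    with good have l: "loses_within (Suc j) (subtree \<omega> (token \<sigma> \<tau> m))" by (simp add: good_def)
    have "owner \<sigma> \<tau> (mover m) (token \<sigma> \<tau> m) < num_children \<omega> (token \<sigma> \<tau> m)"
      if "0 < num_children \<omega> (token \<sigma> \<tau> m)"
      using move_legal[OF legal running that] .
    with l False show ?thesis
      by (auto simp: token_Suc good_def mover_Suc ended_at_def mover_wins_at_def mover_loses_at_def
          simp del: token.simps)
  qed
  \<comment> \<open>The conjunct \<open>i \<le> n\<close> guards against truncated subtraction. It
    survives each round because \<open>good 0 i\<close> is false.\<close>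
  have inv: "good (n - i) i \<and> i \<le> n" if "\<And>m. m < i \<Longrightarrow> \<not> ended_at \<omega> \<sigma> \<tau> m" for i
    using that
  proof (induction i)
    case 0
    then show ?case using start by (auto simp: good_def mover_def split: if_splits)
  next
    case (Suc i)
    then have IH: "good (n - i) i" "i \<le> n" by auto
    then have "i < n" by (cases "i = n") (auto simp: good_def split: if_splits)
    with IH Suc.prems show ?case
      using step[of i "n - Suc i"] by (simp add: Suc_diff_Suc)
  qed
  define m where "m = (LEAST m. ended_at \<omega> \<sigma> \<tau> m)"
  \<comment> \<open>A play still running after \<open>Suc n\<close> rounds would give
    \<open>Suc n \<le> n\<close>.\<close>
  have "\<exists>m. ended_at \<omega> \<sigma> \<tau> m"
    using inv[of "Suc n"] by auto
  then have m: "ended_at \<omega> \<sigma> \<tau> m"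
    unfolding m_def by (rule LeastI_ex)
  have running: "\<not> ended_at \<omega> \<sigma> \<tau> i" if "i < m" for i
    using that unfolding m_def by (rule not_less_Least)
  have "good (n - m) m" using inv running by blast
  then obtain j where "good (Suc j) m"
    by (cases "n - m") (auto simp: good_def split: if_splits)
  from step[OF running this] m
  have "if mover m = P then mover_wins_at \<omega> \<sigma> \<tau> m else mover_loses_at \<omega> \<sigma> \<tau> m"
    by simp
  with running show ?thesis
    unfolding play_won_by_def ended_at_def de_Morgan_disj by blast
qed

text \<open>An infinite play is not a win for \<open>P\<close>, so an invariant without bounds
  suffices: the position is not won when \<open>P\<close> moves and not lost when \<open>Q\<close>
  moves. If the play ends while this holds, it does not end in favour of \<open>P\<close>.\<close>

lemma not_play_won_byI:
  assumes legal: "\<And>Q. legal_strategy \<omega> (owner \<sigma> \<tau> Q)" and "P \<noteq> Q"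
    and best: "\<And>v. \<not> loses (subtree \<omega> v) \<Longrightarrow> edge_label \<omega> (v @ [owner \<sigma> \<tau> Q v]) = Target \<or>
      edge_label \<omega> (v @ [owner \<sigma> \<tau> Q v]) = Safe \<and> \<not> wins (subtree \<omega> (v @ [owner \<sigma> \<tau> Q v]))"
    and start: "if P = First then \<not> wins \<omega> else \<not> loses \<omega>"
  shows "\<not> play_won_by \<omega> \<sigma> \<tau> P"
proof
  define good where "good m \<longleftrightarrow> (if mover m = P then \<not> wins (subtree \<omega> (token \<sigma> \<tau> m))
    else \<not> loses (subtree \<omega> (token \<sigma> \<tau> m)))" for m
  have mover: "mover m = Q" if "mover m \<noteq> P" for m
    using that \<open>P \<noteq> Q\<close> by (cases "mover m"; cases P; cases Q) auto
  have step: "if ended_at \<omega> \<sigma> \<tau> m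
      then \<not> (if mover m = P then mover_wins_at \<omega> \<sigma> \<tau> m else mover_loses_at \<omega> \<sigma> \<tau> m)
      else good (Suc m)"
    if running: "\<And>i. i < m \<Longrightarrow> \<not> ended_at \<omega> \<sigma> \<tau> i" and good: "good m" for m
  proof (cases "mover m = P")
    case True
    with good have w: "\<not> wins (subtree \<omega> (token \<sigma> \<tau> m))" by (simp add: good_def)
    have "owner \<sigma> \<tau> (mover m) (token \<sigma> \<tau> m) < num_children \<omega> (token \<sigma> \<tau> m)"
      if "0 < num_children \<omega> (token \<sigma> \<tau> m)"
      using move_legal[OF legal running that] .
    with w[unfolded wins_iff[of "subtree _ _"]] True show ?thesis
      using not_ended_at_iff[of \<omega> \<sigma> \<tau> m]
      by (auto simp: token_Suc good_def mover_Suc mover_wins_at_def simp del: token.simps)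
  next
    case False
    with good have l: "\<not> loses (subtree \<omega> (token \<sigma> \<tau> m))" by (simp add: good_def)
    then have "0 < num_children \<omega> (token \<sigma> \<tau> m)"
      by (auto simp: loses_iff[of "subtree _ _"])
    with best[OF l] False mover[OF False] show ?thesis
      using not_ended_at_iff[of \<omega> \<sigma> \<tau> m]
      by (auto simp: token_Suc good_def mover_Suc mover_loses_at_def simp del: token.simps)
  qed
  assume "play_won_by \<omega> \<sigma> \<tau> P"
  then obtain n where running: "\<And>m. m < n \<Longrightarrow> \<not> ended_at \<omega> \<sigma> \<tau> m"
    and n: "if mover n = P then mover_wins_at \<omega> \<sigma> \<tau> n else mover_loses_at \<omega> \<sigma> \<tau> n"
    by (auto simp: play_won_by_def ended_at_def)
  have "good m" if "m \<le> n" for m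
    using that
  proof (induction m)
    case 0
    then show ?case using start by (auto simp: good_def mover_def split: if_splits)
  next
    case (Suc m)
    then show ?case using step[of m] running by simp
  qed
  then have "good n" by simp
  from step[OF running this] n show False
    by (auto simp: ended_at_def split: if_splits)
qed

lemma legal_owner:
  "legal_strategy \<omega> \<sigma> \<Longrightarrow> legal_strategy \<omega> \<tau> \<Longrightarrow> legal_strategy \<omega> (owner \<sigma> \<tau> P)"
  by (cases P) simp_all

text \<open>In \<open>won\<close> the length of the play may vary with the opponent's strategy,
  while \<open>wins\<close> asks for a uniform bound. The gap closes because, when
  \<open>wins\<close> fails, a single non-losing strategy of the second player defeats every
  strategy of the first.\<close>

lemma won_iff_wins: "won \<omega> \<longleftrightarrow> wins \<omega>"
proof
  assume "wins \<omega>"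
  then obtain n where n: "wins_within n \<omega>" by (auto simp: wins_def)
  obtain \<rho> where \<rho>: "legal_strategy \<omega> \<rho>"
    "\<And>v n. wins_within (Suc n) (subtree \<omega> v) \<Longrightarrow> edge_label \<omega> (v @ [\<rho> v]) = Target \<or>
      edge_label \<omega> (v @ [\<rho> v]) = Safe \<and> loses_within n (subtree \<omega> (v @ [\<rho> v]))"
    using exists_winning_strategy by blast
  have "play_won_by \<omega> \<rho> \<tau> First" if "legal_strategy \<omega> \<tau>" for \<tau>
    by (rule play_won_byI[where n = n]) (use that n \<rho> in \<open>auto intro: legal_owner\<close>)
  with \<rho>(1) show "won \<omega>" by (auto simp: won_def)
next
  obtain \<rho> where \<rho>: "legal_strategy \<omega> \<rho>"
    "\<And>v. \<not> loses (subtree \<omega> v) \<Longrightarrow> edge_label \<omega> (v @ [\<rho> v]) = Target \<or>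
      edge_label \<omega> (v @ [\<rho> v]) = Safe \<and> \<not> wins (subtree \<omega> (v @ [\<rho> v]))"
    using exists_non_losing_strategy by blast
  assume "won \<omega>"
  then obtain \<sigma> where \<sigma>: "legal_strategy \<omega> \<sigma>" "play_won_by \<omega> \<sigma> \<rho> First"
    using \<rho>(1) by (auto simp: won_def)
  show "wins \<omega>"
  proof (rule ccontr)
    assume "\<not> wins \<omega>"
    have "\<not> play_won_by \<omega> \<sigma> \<rho> First"
      by (rule not_play_won_byI[where Q = Second])
        (use \<sigma> \<rho> \<open>\<not> wins \<omega>\<close> in \<open>auto intro: legal_owner\<close>)
    with \<sigma> show False by simp
  qed
qed

lemma lost_iff_loses: "lost \<omega> \<longleftrightarrow> loses \<omega>"
proof
  assume "loses \<omega>"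
  then obtain n where n: "loses_within n \<omega>" by (auto simp: loses_def)
  obtain \<rho> where \<rho>: "legal_strategy \<omega> \<rho>"
    "\<And>v n. wins_within (Suc n) (subtree \<omega> v) \<Longrightarrow> edge_label \<omega> (v @ [\<rho> v]) = Target \<or>
      edge_label \<omega> (v @ [\<rho> v]) = Safe \<and> loses_within n (subtree \<omega> (v @ [\<rho> v]))"
    using exists_winning_strategy by blast
  have "play_won_by \<omega> \<sigma> \<rho> Second" if "legal_strategy \<omega> \<sigma>" for \<sigma>
    by (rule play_won_byI[where n = n]) (use that n \<rho> in \<open>auto intro: legal_owner\<close>)
  with \<rho>(1) show "lost \<omega>" by (auto simp: lost_def)
next
  obtain \<rho> where \<rho>: "legal_strategy \<omega> \<rho>"
    "\<And>v. \<not> loses (subtree \<omega> v) \<Longrightarrow> edge_label \<omega> (v @ [\<rho> v]) = Target \<or>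
      edge_label \<omega> (v @ [\<rho> v]) = Safe \<and> \<not> wins (subtree \<omega> (v @ [\<rho> v]))"
    using exists_non_losing_strategy by blast
  assume "lost \<omega>"
  then obtain \<tau> where \<tau>: "legal_strategy \<omega> \<tau>" "play_won_by \<omega> \<rho> \<tau> Second"
    using \<rho>(1) by (auto simp: lost_def)
  show "loses \<omega>"
  proof (rule ccontr)
    assume "\<not> loses \<omega>"
    have "\<not> play_won_by \<omega> \<rho> \<tau> Second"
      by (rule not_play_won_byI[where Q = First])
        (use \<tau> \<rho> \<open>\<not> loses \<omega>\<close> in \<open>auto intro: legal_owner\<close>)
    with \<tau> show False by simp
  qed
qed


section \<open>The branching recursion\<close>

lemma space_game_space [simp]: "space (game_space D p q) = UNIV"
  by (simp add: game_space_def space_PiM PiE_UNIV_domain)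

lemma prob_space_game_space: "prob_space (game_space D p q)"
  unfolding game_space_def by (intro prob_space_PiM measure_pmf.prob_space_axioms)

lemma measurable_coordinate:
  "(\<lambda>\<omega>. \<omega> v) \<in> measurable (\<Pi>\<^sub>M v\<in>UNIV. measure_pmf (pair_pmf D (label_pmf p q)))
    (measure_pmf (pair_pmf D (label_pmf p q)))"
  by (rule measurable_component_singleton) simp

lemma measurable_fun_of_vertex: "(\<lambda>\<omega>. f (\<omega> v)) \<in> measurable (game_space D p q) (count_space UNIV)"
  unfolding game_space_def by (rule measurable_compose[OF measurable_coordinate]) simp

lemma measurable_num_children [measurable]:
  "(\<lambda>\<omega>. num_children \<omega> v) \<in> measurable (game_space D p q) (count_space UNIV)"
  unfolding num_children_def by (rule measurable_fun_of_vertex)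

lemma measurable_edge_label [measurable]:
  "(\<lambda>\<omega>. edge_label \<omega> v) \<in> measurable (game_space D p q) (count_space UNIV)"
  unfolding edge_label_def by (rule measurable_fun_of_vertex)

lemma measurable_subtree [measurable]:
  "(\<lambda>\<omega>. subtree \<omega> v) \<in> measurable (game_space D p q) (game_space D p q)"
  unfolding subtree_def game_space_def
  by (rule measurable_PiM_single', rule measurable_coordinate) (auto simp: space_PiM)

lemma measurable_within:
  "Measurable.pred (game_space D p q) (wins_within n) \<and>
   Measurable.pred (game_space D p q) (loses_within n)"
proof (induction n)
  case (Suc n)
  note [measurable] = Suc[THEN conjunct1] Suc[THEN conjunct2]
  show ?case unfolding wins_within.simps loses_within.simps by measurable
qed simp

lemma measurable_wins [measurable]: "Measurable.pred (game_space D p q) wins"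
  and measurable_loses [measurable]: "Measurable.pred (game_space D p q) loses"
proof -
  note [measurable] = measurable_within[THEN conjunct1] measurable_within[THEN conjunct2]
  show "Measurable.pred (game_space D p q) wins" "Measurable.pred (game_space D p q) loses"
    unfolding wins_def[abs_def] loses_def[abs_def] by measurable
qed

section \<open>Independence of the root and the subtrees\<close>

text \<open>The shift \<open>u \<mapsto> v @ u\<close> is injective and the coordinates are i.i.d.,
  so reindexing preserves the product law.\<close>

lemma distr_subtree: "distr (game_space D p q) (game_space D p q) (\<lambda>\<omega>. subtree \<omega> v) = game_space D p q"
  unfolding subtree_def game_space_def
  using distr_PiM_reindex[of UNIV "\<lambda>_. measure_pmf (pair_pmf D (label_pmf p q))" "\<lambda>u. v @ u" UNIV]
  by (simp add: measure_pmf.prob_space_axioms inj_def restrict_UNIV)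

text \<open>The root and the subtrees at distinct children use disjoint sets of coordinates. Here
  \<open>n\<close> is a fixed number, not the number of children, so the events on the subtrees do
  not involve the root.\<close>

lemma prob_root_and_subtrees:
  assumes A [measurable]: "A \<in> sets (game_space D p q)"
  shows "measure (game_space D p q) {\<omega>. \<omega> [] \<in> C \<and> (\<forall>k<n. subtree \<omega> [k] \<in> A)} =
    measure_pmf.prob (pair_pmf D (label_pmf p q)) C * measure (game_space D p q) A ^ n"
proof -
  let ?M = "game_space D p q" and ?N = "measure_pmf (pair_pmf D (label_pmf p q))"
  interpret prob_space ?M by (rule prob_space_game_space)
  \<comment> \<open>Blocks of coordinates: \<open>None\<close> stands for the root,
    \<open>Some k\<close> for all words starting with \<open>k\<close>.\<close>
  define K :: "nat option \<Rightarrow> vertex set"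
    where "K i = (case i of None \<Rightarrow> {[]} | Some k \<Rightarrow> range (\<lambda>v. k # v))" for i
  define X where "X i \<omega> = restrict \<omega> (K i)" for i and \<omega> :: env
  \<comment> \<open>The root event and the subtree events, rewritten as events of a single
    block.\<close>
  define E where "E i = (case i of None \<Rightarrow> {f \<in> space (PiM (K i) (\<lambda>_. ?N)). f [] \<in> C}
    | Some k \<Rightarrow> {f \<in> space (PiM (K i) (\<lambda>_. ?N)). (\<lambda>v. f (k # v)) \<in> A})" for i
  have component: "distr ?M ?N (\<lambda>\<omega>. \<omega> v) = ?N" for v
    unfolding game_space_def
    by (rule distr_PiM_component) (simp_all add: measure_pmf.prob_space_axioms)
  \<comment> \<open>The coordinates are independent because their joint law is the product of their
    marginals; grouping them into disjoint blocks keeps independence.\<close>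
  have "indep_vars (\<lambda>_. ?N) (\<lambda>v \<omega>. \<omega> v) UNIV"
  proof (subst indep_vars_iff_distr_eq_PiM)
    show "random_variable ?N (\<lambda>\<omega>. \<omega> v)" for v
      unfolding game_space_def by (rule measurable_coordinate)
    show "distr ?M (\<Pi>\<^sub>M v\<in>UNIV. ?N) (\<lambda>\<omega>. \<lambda>v\<in>UNIV. \<omega> v) = (\<Pi>\<^sub>M v\<in>UNIV. distr ?M ?N (\<lambda>\<omega>. \<omega> v))"
      unfolding component by (simp add: restrict_UNIV game_space_def)
  qed simp
  then have "indep_vars (\<lambda>i. PiM (K i) (\<lambda>_. ?N)) (\<lambda>i \<omega>. restrict (\<lambda>v. \<omega> v) (K i)) UNIV"
    by (rule indep_vars_restrict) (auto simp: K_def disjoint_family_on_def split: option.splits)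
  then have indep: "indep_vars (\<lambda>i. PiM (K i) (\<lambda>_. ?N)) X UNIV"
    by (simp add: X_def[abs_def])
  have E: "E i \<in> sets (PiM (K i) (\<lambda>_. ?N))" for i
  proof (cases i)
    case None
    have "(\<lambda>f. f []) \<in> measurable (PiM (K None) (\<lambda>_. ?N)) ?N"
      by (rule measurable_component_singleton) (simp add: K_def)
    from measurable_sets[OF this, of C] show ?thesis
      unfolding None by (simp add: E_def vimage_def Int_def conj_commute)
  next
    case (Some k)
    have "(\<lambda>f v. f (k # v)) \<in> measurable (PiM (K (Some k)) (\<lambda>_. ?N)) ?M"
      unfolding game_space_def
      by (rule measurable_PiM_single') (auto simp: K_def space_PiM intro!: measurable_component_singleton)
    from measurable_sets[OF this A] show ?thesis
      unfolding Some by (simp add: E_def vimage_def Int_def conj_commute)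
  qed
  have vimage_None: "X None -` E None \<inter> space ?M = {\<omega>. \<omega> [] \<in> C}"
    by (auto simp: X_def E_def K_def space_PiM)
  have vimage_Some: "X (Some k) -` E (Some k) \<inter> space ?M = {\<omega>. subtree \<omega> [k] \<in> A}" for k
    by (auto simp: X_def E_def K_def space_PiM subtree_def)
  have "(\<lambda>\<omega>. \<omega> []) \<in> measurable ?M ?N"
    unfolding game_space_def by (rule measurable_coordinate)
  from measure_distr[OF this, of C]
  have root: "prob {\<omega>. \<omega> [] \<in> C} = measure_pmf.prob (pair_pmf D (label_pmf p q)) C"
    by (simp add: component vimage_def)
  have subtree: "prob {\<omega>. subtree \<omega> [k] \<in> A} = prob A" for k
    using measure_distr[OF measurable_subtree A] by (simp add: distr_subtree vimage_def)
  let ?J = "insert None (Some ` {..<n})"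
  have "{\<omega>. \<omega> [] \<in> C \<and> (\<forall>k<n. subtree \<omega> [k] \<in> A)} = (\<Inter>i\<in>?J. X i -` E i \<inter> space ?M)"
    using vimage_None vimage_Some by auto
  also have "prob \<dots> = (\<Prod>i\<in>?J. prob (X i -` E i \<inter> space ?M))"
    by (rule indep_varsD[OF indep]) (use E in auto)
  also have "\<dots> = prob {\<omega>. \<omega> [] \<in> C} * prob A ^ n"
    by (simp add: vimage_None vimage_Some subtree prod.reindex del: space_game_space)
  finally show ?thesis by (simp add: root)
qed

text \<open>Split by the number \<open>n\<close> of children and apply the previous lemma with root
  event \<open>{n} \<times> B\<close>. The set \<open>B\<close> constrains the root label, which is
  the label of the incoming edge once the tree is taken as a subtree.\<close>

lemma prob_branching:
  assumes A [measurable]: "A \<in> sets (game_space D p q)"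
  shows "(\<lambda>n. pmf D n * measure (game_space D p q) A ^ n * measure_pmf.prob (label_pmf p q) B) sums
    measure (game_space D p q)
      {\<omega>. edge_label \<omega> [] \<in> B \<and> (\<forall>k<num_children \<omega> []. subtree \<omega> [k] \<in> A)}"
proof -
  let ?M = "game_space D p q"
  interpret prob_space ?M by (rule prob_space_game_space)
  have [measurable]: "Measurable.pred ?M (\<lambda>\<omega>. \<omega> [] \<in> {n} \<times> B)" for n
    by (rule measurable_fun_of_vertex)
  let ?F = "\<lambda>n. {\<omega> \<in> space ?M. \<omega> [] \<in> {n} \<times> B \<and> (\<forall>k<n. subtree \<omega> [k] \<in> A)}"
  have "(\<lambda>n. prob (?F n)) sums prob (\<Union>n. ?F n)"
  proof (rule finite_measure_UNION)
    show "range ?F \<subseteq> events"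
      by (rule image_subsetI) measurable
  qed (auto simp: disjoint_family_on_def)
  moreover have "prob (?F n) = pmf D n * prob A ^ n * measure_pmf.prob (label_pmf p q) B" for n
  proof -
    have "finite B" by (rule finite_subset[OF subset_UNIV]) (simp add: UNIV_label)
    then have "countable B" by (rule countable_finite)
    with prob_root_and_subtrees[OF A, of "{n} \<times> B" n] show ?thesis
      by (simp add: measure_pmf_prob_product measure_pmf_single)
  qed
  moreover have "(\<Union>n. ?F n) =
      {\<omega>. edge_label \<omega> [] \<in> B \<and> (\<forall>k<num_children \<omega> []. subtree \<omega> [k] \<in> A)}"
    by (auto simp: num_children_def edge_label_def mem_Times_iff)
  ultimately show ?thesis by simp
qed

text \<open>The series is geometric with ratio \<open>(1 - \<pi>) * x\<close>, which is below 1
  because \<open>\<pi>\<close> is positive. Its sum is the generating function of the offspring law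
  at \<open>x\<close>, times the label probability.\<close>

lemma prob_branching_geometric:
  assumes \<pi>: "0 < \<pi>" "\<pi> \<le> 1" and A: "A \<in> sets (game_space (geometric_pmf \<pi>) p q)"
  defines "x \<equiv> measure (game_space (geometric_pmf \<pi>) p q) A"
  shows "measure (game_space (geometric_pmf \<pi>) p q)
      {\<omega>. edge_label \<omega> [] \<in> B \<and> (\<forall>k<num_children \<omega> []. subtree \<omega> [k] \<in> A)} =
    \<pi> / (1 - (1 - \<pi>) * x) * measure_pmf.prob (label_pmf p q) B"
proof -
  interpret prob_space "game_space (geometric_pmf \<pi>) p q" by (rule prob_space_game_space)
  have x: "0 \<le> x" "x \<le> 1" by (simp_all add: x_def)
  have "(1 - \<pi>) * x \<le> (1 - \<pi>) * 1" using x \<pi> by (intro mult_left_mono) auto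
  then have "norm ((1 - \<pi>) * x) < 1" using x \<pi> by simp
  from sums_mult2[OF sums_mult2[OF geometric_sums[OF this], of \<pi>],
      of "measure_pmf.prob (label_pmf p q) B"]
  have "(\<lambda>n. pmf (geometric_pmf \<pi>) n * x ^ n * measure_pmf.prob (label_pmf p q) B) sums
      (\<pi> / (1 - (1 - \<pi>) * x) * measure_pmf.prob (label_pmf p q) B)"
    using \<pi> by (simp add: power_mult_distrib mult_ac)
  with prob_branching[OF A] show ?thesis
    unfolding x_def by (rule sums_unique2)
qed

theorem mainTheorem10:
  fixes \<pi> p q :: real
  assumes "0 < \<pi>" "\<pi> \<le> 1"
    and "p \<in> {0..1}" "q \<in> {0..1}" "0 < p + q" "p + q < 1"
  shows "{\<omega> \<in> space (game_space (geometric_pmf \<pi>) p q). draw \<omega>}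
           \<in> sets (game_space (geometric_pmf \<pi>) p q) \<and>
         measure (game_space (geometric_pmf \<pi>) p q)
           {\<omega> \<in> space (game_space (geometric_pmf \<pi>) p q). draw \<omega>} = 0"
proof -
  let ?M = "game_space (geometric_pmf \<pi>) p q" and ?r = "1 - \<pi>" and ?s = "1 - p - q"
  let ?lab = "measure_pmf.prob (label_pmf p q)"
  interpret prob_space ?M by (rule prob_space_game_space)
  define a b where "a = prob {\<omega>. \<not> wins \<omega>}" and "b = prob {\<omega>. loses \<omega>}"
  \<comment> \<open>Both events are to be evaluated on the subtree at a child: \<open>A\<close> says
    that moving there does not force a win, \<open>B\<close> that it lets the opponent force
    one.\<close>
  define A where "A = {\<omega>. edge_label \<omega> [] = Trap \<or> edge_label \<omega> [] = Safe \<and> \<not> loses \<omega>}"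
  define B where "B = {\<omega>. edge_label \<omega> [] = Trap \<or> edge_label \<omega> [] = Safe \<and> wins \<omega>}"
  have meas: "{\<omega>. \<not> wins \<omega>} \<in> events" "{\<omega>. loses \<omega>} \<in> events" "A \<in> events" "B \<in> events"
    "{\<omega>. edge_label \<omega> [] \<in> {Trap, Safe}} \<in> events"
    "{\<omega>. edge_label \<omega> [] = Safe \<and> \<not> wins \<omega>} \<in> events"
    "{\<omega>. edge_label \<omega> [] = Safe \<and> loses \<omega>} \<in> events"
  proof -
    have events: "{\<omega>. P \<omega>} \<in> events" if "Measurable.pred ?M P" for P
      using that by (simp add: pred_def)
    show "{\<omega>. \<not> wins \<omega>} \<in> events" by (rule events) measurable
    show "{\<omega>. loses \<omega>} \<in> events" by (rule events) measurable
    show "A \<in> events" unfolding A_def by (rule events) measurable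
    show "B \<in> events" unfolding B_def by (rule events) measurable
    show "{\<omega>. edge_label \<omega> [] \<in> {Trap, Safe}} \<in> events"
      by (rule events) simp
    show "{\<omega>. edge_label \<omega> [] = Safe \<and> \<not> wins \<omega>} \<in> events" by (rule events) measurable
    show "{\<omega>. edge_label \<omega> [] = Safe \<and> loses \<omega>} \<in> events" by (rule events) measurable
  qed
  note branching = prob_branching_geometric[OF assms(1,2), of _ p q]
  have not_wins: "\<not> wins \<omega> \<longleftrightarrow> (\<forall>k<num_children \<omega> []. subtree \<omega> [k] \<in> A)" for \<omega>
    unfolding wins_iff[of \<omega>] A_def by (auto simp: not_Target_iff)
  have loses: "loses \<omega> \<longleftrightarrow> (\<forall>k<num_children \<omega> []. subtree \<omega> [k] \<in> B)" for \<omega>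
    unfolding loses_iff[of \<omega>] B_def by auto
  have lab: "?lab {Safe} = ?s" "?lab {Trap, Safe} = p + ?s"
    using assms pmf_label_pmf[of p q]
    by (simp_all add: measure_pmf_single measure_measure_pmf_finite)
  \<comment> \<open>With the whole space as the subtree event only the label condition remains, and
    the generating function at 1 equals 1.\<close>
  have label_prob: "prob {\<omega>. edge_label \<omega> [] \<in> L} = ?lab L" for L
    using prob_branching_geometric[OF assms(1,2) sets.top, of p q L] assms(1) prob_space by simp
  have a: "a = \<pi> / (1 - ?r * prob A)"
    using branching[OF meas(3), of UNIV] unfolding a_def by (simp add: not_wins)
  have b: "b = \<pi> / (1 - ?r * prob B)"
    using branching[OF meas(4), of UNIV] unfolding b_def by (simp flip: loses)
  \<comment> \<open>Winning depends on the number of children and the subtrees, not on the root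
    label, so the probability factors.\<close>
  have safe_a: "prob {\<omega>. edge_label \<omega> [] = Safe \<and> \<not> wins \<omega>} = ?s * a"
    using branching[OF meas(3), of "{Safe}"] by (simp add: not_wins a lab)
  have safe_b: "prob {\<omega>. edge_label \<omega> [] = Safe \<and> loses \<omega>} = ?s * b"
    using branching[OF meas(4), of "{Safe}"] by (simp add: loses b lab)
  \<comment> \<open>The event \<open>\<not> loses \<omega>\<close> is not of the form "all subtrees
    lie in a set", so \<open>prob A\<close> is computed as a difference of events that the branching
    lemma covers.\<close>
  have "A = {\<omega>. edge_label \<omega> [] \<in> {Trap, Safe}} - {\<omega>. edge_label \<omega> [] = Safe \<and> loses \<omega>}"
    by (auto simp: A_def)
  then have pA: "prob A = p + ?s - ?s * b"
    using label_prob[of "{Trap, Safe}"] safe_b lab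
    by (simp only:) (subst finite_measure_Diff, use meas in auto)
  have "B = {\<omega>. edge_label \<omega> [] \<in> {Trap, Safe}} - {\<omega>. edge_label \<omega> [] = Safe \<and> \<not> wins \<omega>}"
    by (auto simp: B_def)
  then have pB: "prob B = p + ?s - ?s * a"
    using label_prob[of "{Trap, Safe}"] safe_a lab
    by (simp only:) (subst finite_measure_Diff, use meas in auto)
  have nonzero: "1 - ?r * x \<noteq> 0" if "0 \<le> x" "x \<le> 1" for x :: real
    using mult_left_mono[OF that(2), of ?r] assms by simp
  have "a * (1 - ?r * prob A) = \<pi>" "b * (1 - ?r * prob B) = \<pi>"
    using nonzero[of "prob A"] nonzero[of "prob B"] by (simp_all add: a b)
  then have "a * (1 - ?r * (p + ?s - ?s * b)) = \<pi>" "b * (1 - ?r * (p + ?s - ?s * a)) = \<pi>"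
    unfolding pA pB .
  \<comment> \<open>Both equations contain the same term \<open>?r * ?s * a * b\<close>, and
    \<open>p + ?s = 1 - q\<close>.\<close>
  then have "(a - b) * (1 - ?r * (1 - q)) = 0"
    by (simp add: algebra_simps)
  then have "a = b"
    using nonzero[of "1 - q"] assms by simp
  have draw: "{\<omega> \<in> space ?M. draw \<omega>} = {\<omega>. \<not> wins \<omega>} - {\<omega>. loses \<omega>}"
    by (auto simp: draw_def won_iff_wins lost_iff_loses)
  \<comment> \<open>The probabilities subtract because a lost game is never won.\<close>
  have "prob ({\<omega>. \<not> wins \<omega>} - {\<omega>. loses \<omega>}) = a - b"
    unfolding a_def b_def using meas loses_imp_not_wins by (intro finite_measure_Diff) auto
  with draw meas \<open>a = b\<close> show ?thesis by auto
qed

end
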